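(* Let $n\geqslant 1$ and $\kappa\geqslant n$ be integers. If $\alpha_1,\dots,\alpha_n$ are any nonnegative integers satisfying $\alpha_1+\cdots+\alpha_n\leqslant\frac{n(n+1)}{2}-1$, then there is a constant $C_{n,\kappa}>0$ depending only on $n$ and $\kappa$ such that for every integer $m\geqslant 1$: \[ \begin{aligned} &\sum_{\ell_1\geqslant\ell_2\geqslant\cdots\geqslant\ell_n\geqslant 0} M_{\ell_1,\ell_2,\dots,\ell_n}^{\kappa,m}\cdot(\ell_1-\ell_2)^{\alpha_1}\cdots(\ell_{n-1}-\ell_n)^{\alpha_{n-1}}(\ell_n)^{\alpha_n} \\ &\quad=\sum_{\substack{\mathsf{YT}\ \text{semi-standard}\\ \mathrm{weight}(\mathsf{YT})=m}} \big(\ell_1(\mathsf{YT})-\ell_2(\mathsf{YT})\big)^{\alpha_1}\cdots\big(\ell_{n-1}(\mathsf{YT})-\ell_n(\mathsf{YT})\big)^{\alpha_{n-1}}\big(\ell_n(\mathsf{YT})\big)^{\alpha_n} \\ &\quad\leqslant C_{n,\kappa}\cdot m^{\alpha_1+\cdots+\alpha_n}\cdot m^{n\kappa-\frac{n(n-1)}{2}-1} \\ &\quad\leqslant C_{n,\kappa}\cdot m^{(\kappa+1)n-2}. \end{aligned} \]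
   Context: Semi-standard Young tableaux $\mathsf{YT}$ here have at most $n$ rows, with row lengths $\ell_1(\mathsf{YT})\geqslant\cdots\geqslant\ell_n(\mathsf{YT})\geqslant 0$ (zero allowed), and are filled with integers $\lambda_i^j\in\{1,\dots,\kappa\}$ (row $i$, column $j$) that are weakly increasing from left to right along rows and strictly increasing from top to bottom along columns. The weight of $\mathsf{YT}$ is the sum of all its entries $\lambda_i^j$. $M_{\ell_1,\dots,\ell_n}^{\kappa,m}$ denotes the number of such tableaux with row lengths $\ell_1,\dots,\ell_n$ and weight $m$. Convention: $0^0=1$. *)

theory Defs
  imports "HOL-Analysis.Infinite_Sum"
begin

text \<open>
  A tableau with at most \<open>n\<close> rows is a list of exactly \<open>n\<close> rows, where trailing rows may be empty.
  Each tableau thus has a unique representation. All indices start at 0: row \<open>i\<close> of the mathematical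
  text is \<open>T ! (i - 1)\<close>, and its length is \<open>map length T ! (i - 1)\<close>.
\<close>

definition row_shapes :: "nat \<Rightarrow> nat list set" where
  "row_shapes n = {l. length l = n \<and> sorted_wrt (\<ge>) l}"

definition semistandard :: "nat \<Rightarrow> nat \<Rightarrow> nat list list \<Rightarrow> bool" where
  "semistandard n \<kappa> T \<longleftrightarrow>
     map length T \<in> row_shapes n \<and>
     (\<forall>r\<in>set T. set r \<subseteq> {1..\<kappa>} \<and> sorted r) \<and>
     (\<forall>i i' j. i < i' \<and> i' < n \<and> j < length (T ! i') \<longrightarrow> T ! i ! j < T ! i' ! j)"

definition weight :: "nat list list \<Rightarrow> nat" where
  "weight T = sum_list (map sum_list T)"

definition tableaux :: "nat \<Rightarrow> nat \<Rightarrow> nat \<Rightarrow> nat list list set" where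
  "tableaux n \<kappa> m = {T. semistandard n \<kappa> T \<and> weight T = m}"

definition num_tableaux :: "nat \<Rightarrow> nat \<Rightarrow> nat \<Rightarrow> nat list \<Rightarrow> nat" where
  "num_tableaux n \<kappa> m l = card {T \<in> tableaux n \<kappa> m. map length T = l}"

text \<open>
  \<open>(l\<^sub>1 - l\<^sub>2)^\<alpha>\<^sub>1 \<dots> (l\<^sub>n\<^sub>-\<^sub>1 - l\<^sub>n)^\<alpha>\<^sub>n\<^sub>-\<^sub>1 l\<^sub>n^\<alpha>\<^sub>n\<close>, with indices shifted to start at 0.
  The library's power satisfies \<open>0 ^ 0 = 1\<close>.
\<close>

definition gap_monomial :: "nat \<Rightarrow> (nat \<Rightarrow> nat) \<Rightarrow> nat list \<Rightarrow> real" where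
  "gap_monomial n \<alpha> l =
     (\<Prod>i<n - 1. (real (l ! i) - real (l ! Suc i)) ^ \<alpha> i) * real (l ! (n - 1)) ^ \<alpha> (n - 1)"

text \<open>
  Since \<open>card\<close> and \<open>sum\<close> are 0 on infinite sets, finiteness is needed for \<open>num_tableaux\<close> and
  for sums over \<open>tableaux\<close> to have their intended meaning.
\<close>

lemma finite_tableaux: "finite (tableaux n \<kappa> m)"
proof (rule finite_subset)
  let ?R = "{r. set r \<subseteq> {1..\<kappa>} \<and> length r \<le> m}"
  show "tableaux n \<kappa> m \<subseteq> {T. set T \<subseteq> ?R \<and> length T \<le> n}"
  proof
    fix T assume T: "T \<in> tableaux n \<kappa> m"
    have "length r \<le> m" if r: "r \<in> set T" for r
    proof -
      have "\<forall>x\<in>set r. 1 \<le> x"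
        using T r by (force simp: tableaux_def semistandard_def)
      then have "length r \<le> sum_list r"
        by (induction r) auto
      also have "sum_list r \<le> sum_list (map sum_list T)"
        using r by (intro member_le_sum_list) auto
      also have "\<dots> = m"
        using T by (simp add: tableaux_def weight_def)
      finally show ?thesis .
    qed
    then show "T \<in> {T. set T \<subseteq> ?R \<and> length T \<le> n}"
      using T by (auto simp: tableaux_def semistandard_def row_shapes_def)
  qed
  show "finite {T. set T \<subseteq> ?R \<and> length T \<le> n}"
    by (intro finite_lists_length_le finite_atLeastAtMost)
qed

end

theory Submission
  imports Defs "HOL-Library.Multiset"
begin

text \<open>
  The estimate is a count of free parameters. A sorted row is determined by how often each value
  occurs in it, and strictness of the columns forces the row with index \<open>i\<close> to use only the values
  \<open>i + 1, \<dots>, \<kappa>\<close>. A tableau is therefore the same as its multiplicities at the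
  \<open>N = \<Sum>i<n. (\<kappa> - i) = n * \<kappa> - n * (n - 1) / 2\<close> pairs (row, value) of \<open>slots n \<kappa>\<close>. Prescribing
  the weight \<open>m\<close> confines each multiplicity to \<open>{0..m}\<close> and is one linear equation between them, in
  which the value \<open>1\<close> of the top row has coefficient \<open>1\<close>; that multiplicity is thus determined by the
  \<open>N - 1\<close> others. This gives at most \<open>(m + 1) ^ (N - 1) \<le> 2 ^ (N - 1) * m ^ (N - 1)\<close> tableaux
  (\<open>card_tableaux_le\<close>).

  All entries are at least \<open>1\<close>, so every row has length at most \<open>m\<close>. Each gap thus lies between
  \<open>0\<close> and \<open>m\<close>, and the gap monomial is at most \<open>m ^ (\<Sum>i<n. \<alpha> i)\<close> on each tableau
  (\<open>gap_monomial_le\<close>). Multiplying the two bounds gives the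
  main inequality with \<open>C = 2 ^ (N - 1)\<close>. The final inequality only compares exponents, and the
  equality of the two sums groups the tableaux by shape.
\<close>

section \<open>Tableaux as multiplicity functions\<close>

definition slots :: "nat \<Rightarrow> nat \<Rightarrow> (nat \<times> nat) set" where
  "slots n \<kappa> = (SIGMA i:{..<n}. {Suc i..\<kappa>})"

lemma finite_slots: "finite (slots n \<kappa>)"
  by (simp add: slots_def)

lemma card_slots:
  assumes "n \<le> \<kappa>"
  shows "card (slots n \<kappa>) = n * \<kappa> - n * (n - 1) div 2"
proof -
  have "card (slots n \<kappa>) + n * (n - 1) div 2 = n * \<kappa>"
    using assms
  proof (induction n)
    case 0
    then show ?case by (simp add: slots_def)
  next
    case (Suc n)
    have "Suc n * (Suc n - 1) = n * (n - 1) + n * 2"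
      by (cases n) (auto simp: algebra_simps)
    then have "Suc n * (Suc n - 1) div 2 = n * (n - 1) div 2 + n"
      by simp
    then show ?case
      using Suc by (simp add: slots_def)
  qed
  then show ?thesis by linarith
qed

lemma semistandard_length: "semistandard n \<kappa> T \<Longrightarrow> length T = n"
  by (auto simp: semistandard_def row_shapes_def)

lemma semistandard_row_lengths_antimono:
  assumes "semistandard n \<kappa> T" "i \<le> i'" "i' < n"
  shows "length (T ! i') \<le> length (T ! i)"
proof (cases "i = i'")
  case False
  have "sorted_wrt (\<ge>) (map length T)"
    using assms(1) by (auto simp: semistandard_def row_shapes_def)
  then show ?thesis
    using assms False semistandard_length[OF assms(1)]
    by (auto dest!: sorted_wrt_nth_less[of _ _ i i'])
qed simp

text \<open>Going down a column, the entries start at \<open>1\<close> or more and increase by at least \<open>1\<close> per row.\<close>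

lemma semistandard_entry_ge:
  assumes T: "semistandard n \<kappa> T" and "i < n" "j < length (T ! i)"
  shows "Suc i \<le> T ! i ! j"
  using assms(2,3)
proof (induction i)
  case 0
  then have "T ! 0 \<in> set T"
    using semistandard_length[OF T] by simp
  then show ?case
    using T nth_mem[OF "0.prems"(2)] unfolding semistandard_def
    by (metis One_nat_def atLeastAtMost_iff subsetD)
next
  case (Suc i)
  have "j < length (T ! i)"
    using semistandard_row_lengths_antimono[OF T, of i "Suc i"] Suc.prems by simp
  then have "Suc i \<le> T ! i ! j"
    using Suc by simp
  also have "T ! i ! j < T ! Suc i ! j"
    using T Suc.prems by (auto simp: semistandard_def)
  finally show ?case by simp
qed

lemma semistandard_row_values:
  assumes "semistandard n \<kappa> T" "i < n"
  shows "set (T ! i) \<subseteq> {Suc i..\<kappa>}"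
proof
  fix v assume v: "v \<in> set (T ! i)"
  have "T ! i \<in> set T"
    using assms semistandard_length by fastforce
  then have "v \<le> \<kappa>"
    using assms v by (fastforce simp: semistandard_def)
  moreover have "Suc i \<le> v"
    using v semistandard_entry_ge[OF assms] by (auto simp: in_set_conv_nth)
  ultimately show "v \<in> {Suc i..\<kappa>}" by simp
qed

definition multiplicity_at :: "nat list list \<Rightarrow> nat \<times> nat \<Rightarrow> nat" where
  "multiplicity_at T = (\<lambda>(i, v). count_list (T ! i) v)"

lemma weight_eq_sum_multiplicities:
  assumes T: "semistandard n \<kappa> T"
  shows "weight T = (\<Sum>(i, v)\<in>slots n \<kappa>. multiplicity_at T (i, v) * v)"
proof -
  have "weight T = (\<Sum>i<n. sum_list (T ! i))"
    using semistandard_length[OF T]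
    by (simp add: weight_def sum_list_sum_nth atLeast0LessThan)
  also have "\<dots> = (\<Sum>i<n. \<Sum>v\<in>{Suc i..\<kappa>}. count_list (T ! i) v * v)"
    using sum_list_map_eq_sum_count2[OF semistandard_row_values[OF T], where f = "\<lambda>v. v"]
    by (intro sum.cong) auto
  also have "\<dots> = (\<Sum>(i, v)\<in>slots n \<kappa>. multiplicity_at T (i, v) * v)"
    by (simp add: slots_def multiplicity_at_def sum.Sigma)
  finally show ?thesis .
qed

lemma tableau_determined_by_multiplicities:
  assumes S: "semistandard n \<kappa> S" and T: "semistandard n \<kappa> T"
    and eq: "\<And>p. p \<in> slots n \<kappa> \<Longrightarrow> multiplicity_at S p = multiplicity_at T p"
  shows "S = T"
proof (rule nth_equalityI)
  show "length S = length T"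
    using S T semistandard_length by metis
  fix i assume "i < length S"
  then have i: "i < n" using semistandard_length[OF S] by simp
  have "count_list (S ! i) v = count_list (T ! i) v" for v
  proof (cases "v \<in> {Suc i..\<kappa>}")
    case True
    then show ?thesis
      using eq[of "(i, v)"] i by (simp add: slots_def multiplicity_at_def)
  next
    case False
    then show ?thesis
      using semistandard_row_values[OF S i] semistandard_row_values[OF T i]
      by (metis count_notin subsetD)
  qed
  then have "mset (S ! i) = mset (T ! i)"
    by (simp add: multiset_eq_iff count_mset)
  moreover have "sorted (S ! i)" "sorted (T ! i)"
    using S T i semistandard_length[OF S] semistandard_length[OF T]
    by (auto simp: semistandard_def)
  ultimately show "S ! i = T ! i"
    by (metis properties_for_sort)
qed

section \<open>The number of tableaux of given weight\<close>

text \<open>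
  The exponent is one less than the number of slots: the weight equation recovers the
  multiplicity left out.
\<close>

lemma card_tableaux_le:
  assumes "n \<ge> 1" "\<kappa> \<ge> n"
  shows "card (tableaux n \<kappa> m) \<le> (m + 1) ^ (n * \<kappa> - n * (n - 1) div 2 - 1)"
proof -
  \<comment> \<open>The weight equation has coefficient \<open>1\<close> at this slot, so it can be solved for its multiplicity.\<close>
  let ?p = "(0, 1) :: nat \<times> nat"
  let ?I = "slots n \<kappa> - {?p}"
  let ?P = "PiE ?I (\<lambda>_. {..m})"
  let ?f = "\<lambda>T. restrict (multiplicity_at T) ?I"
  have p: "?p \<in> slots n \<kappa>"
    using assms by (auto simp: slots_def)
  have split: "m = multiplicity_at T ?p + (\<Sum>(i, v)\<in>?I. multiplicity_at T (i, v) * v)"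
    if "T \<in> tableaux n \<kappa> m" for T
  proof -
    have "m = (\<Sum>(i, v)\<in>slots n \<kappa>. multiplicity_at T (i, v) * v)"
      using that weight_eq_sum_multiplicities by (auto simp: tableaux_def)
    then show ?thesis
      by (simp add: sum.remove[OF finite_slots p])
  qed
  have "inj_on ?f (tableaux n \<kappa> m)"
  proof (rule inj_onI)
    fix S T assume S: "S \<in> tableaux n \<kappa> m" and T: "T \<in> tableaux n \<kappa> m" and "?f S = ?f T"
    then have eq: "multiplicity_at S q = multiplicity_at T q" if "q \<in> ?I" for q
      using that by (metis restrict_apply')
    have "(\<Sum>(i, v)\<in>?I. multiplicity_at S (i, v) * v) = (\<Sum>(i, v)\<in>?I. multiplicity_at T (i, v) * v)"
    proof (rule sum.cong)
      fix q assume "q \<in> ?I"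
      then show "(case q of (i, v) \<Rightarrow> multiplicity_at S (i, v) * v) =
          (case q of (i, v) \<Rightarrow> multiplicity_at T (i, v) * v)"
        using eq[of q] by (cases q) auto
    qed simp
    then have "multiplicity_at S ?p = multiplicity_at T ?p"
      using split[OF S] split[OF T] by linarith
    then have "multiplicity_at S q = multiplicity_at T q" if "q \<in> slots n \<kappa>" for q
      using eq that by blast
    then show "S = T"
      using S T by (intro tableau_determined_by_multiplicities) (auto simp: tableaux_def)
  qed
  moreover have "?f ` tableaux n \<kappa> m \<subseteq> ?P"
  proof (intro image_subsetI restrict_PiE_iff[THEN iffD2] ballI)
    fix T q assume T: "T \<in> tableaux n \<kappa> m" and q: "q \<in> ?I"
    obtain i v where iv: "q = (i, v)" by (cases q)
    have "multiplicity_at T q \<le> multiplicity_at T q * v"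
      using q by (auto simp: iv slots_def)
    also have "\<dots> \<le> (\<Sum>(i, v)\<in>?I. multiplicity_at T (i, v) * v)"
      using member_le_sum[OF q, of "\<lambda>(i, v). multiplicity_at T (i, v) * v"] finite_slots[of n \<kappa>]
      by (simp add: iv)
    also have "\<dots> \<le> m"
      using split[OF T] by linarith
    finally show "multiplicity_at T q \<in> {..m}" by simp
  qed
  ultimately have "card (tableaux n \<kappa> m) \<le> card ?P"
    by (intro card_inj_on_le finite_PiE) (auto simp: finite_slots)
  also have "card ?P = (m + 1) ^ (n * \<kappa> - n * (n - 1) div 2 - 1)"
    using p card_slots[OF assms(2)] by (simp add: card_PiE finite_slots)
  finally show ?thesis .
qed

section \<open>The gap monomial\<close>

lemma row_length_le_weight:
  assumes "T \<in> tableaux n \<kappa> m" "i < n"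
  shows "length (T ! i) \<le> m"
proof -
  have T: "semistandard n \<kappa> T" "weight T = m"
    using assms by (auto simp: tableaux_def)
  have "\<forall>v\<in>set (T ! i). 1 \<le> v"
    using semistandard_row_values[OF T(1) assms(2)] by fastforce
  then have "length (T ! i) \<le> sum_list (T ! i)"
    using sum_list_mono[of "T ! i" "\<lambda>_. 1" "\<lambda>v. v"] by (simp add: sum_list_triv)
  also have "\<dots> \<le> weight T"
    unfolding weight_def using assms semistandard_length[OF T(1)] by (intro member_le_sum_list) auto
  finally show ?thesis using T by simp
qed

lemma gap_monomial_le:
  assumes T: "T \<in> tableaux n \<kappa> m" and n: "n \<ge> 1"
  shows "gap_monomial n \<alpha> (map length T) \<le> real m ^ (\<Sum>i<n. \<alpha> i)"
proof -
  have ss: "semistandard n \<kappa> T"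
    using T by (simp add: tableaux_def)
  note len = semistandard_length[OF ss]
  let ?l = "map length T"
  have "(\<Prod>i<n - 1. (real (?l ! i) - real (?l ! Suc i)) ^ \<alpha> i) \<le> (\<Prod>i<n - 1. real m ^ \<alpha> i)"
  proof (intro prod_mono conjI)
    fix i assume "i \<in> {..<n - 1}"
    then have i: "i < n" "Suc i < n" by auto
    have "?l ! Suc i \<le> ?l ! i"
      using semistandard_row_lengths_antimono[OF ss, of i "Suc i"] i len by simp
    moreover have "?l ! i \<le> m"
      using row_length_le_weight[OF T] i len by simp
    ultimately show "0 \<le> (real (?l ! i) - real (?l ! Suc i)) ^ \<alpha> i"
      and "(real (?l ! i) - real (?l ! Suc i)) ^ \<alpha> i \<le> real m ^ \<alpha> i"
      by (auto intro!: power_mono)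
  qed
  moreover have "real (?l ! (n - 1)) ^ \<alpha> (n - 1) \<le> real m ^ \<alpha> (n - 1)"
    using row_length_le_weight[OF T, of "n - 1"] n len by (intro power_mono) auto
  ultimately have "gap_monomial n \<alpha> ?l \<le> (\<Prod>i<n - 1. real m ^ \<alpha> i) * real m ^ \<alpha> (n - 1)"
    unfolding gap_monomial_def by (intro mult_mono prod_nonneg) auto
  also have "\<dots> = (\<Prod>i<Suc (n - 1). real m ^ \<alpha> i)"
    by simp
  also have "\<dots> = real m ^ (\<Sum>i<n. \<alpha> i)"
    using n by (simp add: power_sum del: prod.lessThan_Suc)
  finally show ?thesis .
qed

section \<open>Summation over shapes and over tableaux\<close>

text \<open>Only finitely many shapes carry a tableau of weight \<open>m\<close>; the sum over the others vanishes.\<close>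

lemma has_sum_tableaux_by_shape:
  fixes g :: "nat list \<Rightarrow> real"
  shows "((\<lambda>l. real (num_tableaux n \<kappa> m l) * g l) has_sum
           (\<Sum>T\<in>tableaux n \<kappa> m. g (map length T))) (row_shapes n)"
proof (rule has_sum_finite_neutralI)
  let ?B = "map length ` tableaux n \<kappa> m"
  show "finite ?B"
    by (simp add: finite_tableaux)
  show "?B \<subseteq> row_shapes n"
    by (auto simp: tableaux_def semistandard_def)
  show "real (num_tableaux n \<kappa> m l) * g l = 0" if "l \<in> row_shapes n - ?B" for l
  proof -
    have "{T \<in> tableaux n \<kappa> m. map length T = l} = {}"
      using that by auto
    then show ?thesis by (simp only: num_tableaux_def) simp
  qed
  have "(\<Sum>T\<in>tableaux n \<kappa> m. g (map length T)) =
      (\<Sum>l\<in>?B. \<Sum>T | T \<in> tableaux n \<kappa> m \<and> map length T = l. g (map length T))"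
    by (rule sum.image_gen[OF finite_tableaux])
  also have "\<dots> = (\<Sum>l\<in>?B. real (num_tableaux n \<kappa> m l) * g l)"
    by (intro sum.cong) (auto simp: num_tableaux_def)
  finally show "(\<Sum>T\<in>tableaux n \<kappa> m. g (map length T)) =
      (\<Sum>l\<in>?B. real (num_tableaux n \<kappa> m l) * g l)" .
qed

lemma sum_gap_monomial_le:
  assumes "n \<ge> 1" "\<kappa> \<ge> n" "m \<ge> 1"
  defines "d \<equiv> n * \<kappa> - n * (n - 1) div 2 - 1"
  shows "(\<Sum>T\<in>tableaux n \<kappa> m. gap_monomial n \<alpha> (map length T))
    \<le> 2 ^ d * real m ^ (\<Sum>i<n. \<alpha> i) * real m ^ d"
proof -
  have "real (card (tableaux n \<kappa> m)) \<le> real ((m + 1) ^ d)"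
    unfolding d_def using card_tableaux_le[OF assms(1,2)] by (intro of_nat_mono)
  also have "\<dots> \<le> (2 * real m) ^ d"
    unfolding of_nat_power using assms(3) by (intro power_mono) auto
  finally have card: "real (card (tableaux n \<kappa> m)) \<le> 2 ^ d * real m ^ d"
    by (simp add: power_mult_distrib)
  have "(\<Sum>T\<in>tableaux n \<kappa> m. gap_monomial n \<alpha> (map length T))
      \<le> real (card (tableaux n \<kappa> m)) * real m ^ (\<Sum>i<n. \<alpha> i)"
    using gap_monomial_le[OF _ assms(1)] by (intro sum_bounded_above)
  also have "\<dots> \<le> (2 ^ d * real m ^ d) * real m ^ (\<Sum>i<n. \<alpha> i)"
    using card by (intro mult_right_mono) auto
  finally show ?thesis by (simp only: mult_ac)
qed

text \<open>
  The bound on \<open>a\<close> is what makes the quadratic terms cancel: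
  \<open>n * (n + 1) / 2 - n * (n - 1) / 2 = n\<close>.
\<close>

lemma exponent_le:
  fixes n \<kappa> a :: nat
  assumes "n \<ge> 1" "\<kappa> \<ge> n" "a \<le> n * (n + 1) div 2 - 1"
  shows "a + (n * \<kappa> - n * (n - 1) div 2 - 1) \<le> (\<kappa> + 1) * n - 2"
proof -
  have "n * (n + 1) = n * (n - 1) + n * 2"
    using assms(1) by (cases n) (auto simp: algebra_simps)
  then have half: "n * (n + 1) div 2 = n * (n - 1) div 2 + n"
    by simp
  \<comment> \<open>Subtracting \<open>n * (n - 1) div 2 + 1\<close> from \<open>n * \<kappa>\<close> does not truncate.\<close>
  have "n * (n - 1) div 2 + 1 \<le> n * \<kappa>"
  proof -
    have "n * (n - 1) div 2 + 1 \<le> n * (n - 1) + n"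
      using assms(1) by linarith
    also have "\<dots> = n * n"
      using assms(1) by (cases n) auto
    also have "\<dots> \<le> n * \<kappa>"
      using assms(2) by simp
    finally show ?thesis .
  qed
  moreover have "(\<kappa> + 1) * n = n * \<kappa> + n"
    by simp
  ultimately show ?thesis
    using assms(1,3) half by linarith
qed

theorem theorem1p5:
  fixes n \<kappa> :: nat
  assumes "n \<ge> 1" and "\<kappa> \<ge> n"
  shows "\<exists>C::real. C > 0 \<and>
    (\<forall>(\<alpha> :: nat \<Rightarrow> nat) (m :: nat).
       (\<Sum>i<n. \<alpha> i) \<le> n * (n + 1) div 2 - 1 \<longrightarrow> m \<ge> 1 \<longrightarrow>
         ((\<lambda>l. real (num_tableaux n \<kappa> m l) * gap_monomial n \<alpha> l) has_sum
            (\<Sum>T\<in>tableaux n \<kappa> m. gap_monomial n \<alpha> (map length T))) (row_shapes n) \<and>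
         (\<Sum>T\<in>tableaux n \<kappa> m. gap_monomial n \<alpha> (map length T))
           \<le> C * real m ^ (\<Sum>i<n. \<alpha> i) * real m ^ (n * \<kappa> - n * (n - 1) div 2 - 1) \<and>
         C * real m ^ (\<Sum>i<n. \<alpha> i) * real m ^ (n * \<kappa> - n * (n - 1) div 2 - 1)
           \<le> C * real m ^ ((\<kappa> + 1) * n - 2))"
proof (intro exI conjI allI impI)
  let ?d = "n * \<kappa> - n * (n - 1) div 2 - 1"
  let ?C = "2 ^ ?d :: real"
  show "?C > 0" by simp
  fix \<alpha> :: "nat \<Rightarrow> nat" and m :: nat
  assume \<alpha>: "(\<Sum>i<n. \<alpha> i) \<le> n * (n + 1) div 2 - 1" and m: "m \<ge> 1"
  show "((\<lambda>l. real (num_tableaux n \<kappa> m l) * gap_monomial n \<alpha> l) has_sum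
            (\<Sum>T\<in>tableaux n \<kappa> m. gap_monomial n \<alpha> (map length T))) (row_shapes n)"
    by (rule has_sum_tableaux_by_shape)
  show "(\<Sum>T\<in>tableaux n \<kappa> m. gap_monomial n \<alpha> (map length T))
           \<le> ?C * real m ^ (\<Sum>i<n. \<alpha> i) * real m ^ ?d"
    by (rule sum_gap_monomial_le[OF assms m])
  have "real m ^ ((\<Sum>i<n. \<alpha> i) + ?d) \<le> real m ^ ((\<kappa> + 1) * n - 2)"
    using exponent_le[OF assms \<alpha>] m by (intro power_increasing) auto
  then show "?C * real m ^ (\<Sum>i<n. \<alpha> i) * real m ^ ?d \<le> ?C * real m ^ ((\<kappa> + 1) * n - 2)"
    by (simp only: power_add mult.assoc) (simp add: mult_left_mono)
qed

end
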